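(* Let $(S,+,0)$ be a Clifford monoid equipped with a right-subinvariant, skew-convex pseudo-metric $d$. Then the map $v:S\to\mathbb{R}_+$ defined by $$v(x)=d(x,0)+d(\delta x,0)$$ for all $x\in S$ is a pseudo-norm on $S$ such that the metric topology (induced by $d$) and the norm topology (induced by $v$) coincide. Moreover, $v$ is a norm if and only if $d$ is a metric.
   Context: Semigroups are written additively but are not assumed commutative. A semigroup $(S,+)$ is inverse if every $x\in S$ has a unique $x^*\in S$ with $x+x^*+x=x$ and $x^*+x+x^*=x^*$. $E(S)$ denotes the set of idempotents. An inverse monoid is an inverse semigroup with identity element $0$. The natural partial order is: $x\leqslant_S y$ iff $y=x+e$ for some $e\in E(S)$. Write $\delta x:=x+x^*$. An inverse semigroup (monoid) is Clifford if $x+x^*=x^*+x$ for all $x$. A pseudo-norm on an inverse monoid $S$ is a map $\|\cdot\|:S\to\mathbb{R}_+$ with $\|0\|=0$ such that for all $x,y,z\in S$: $\|x+y^*\|=\|y+x^*\|$; $\|x+x^*\|\leqslant\|x+y^*\|$; and $\|x+y^*\|+\|z+z^*\|\leqslant\|x+z^*\|+\|z+y^*\|$. For $e\in E(S)$ let $S_e=\{x\in S: x+e=e+x=x\}$. A norm is a pseudo-norm such that, for all $e\in E(S)$ and $x\in S_e$, $\|x\|=\|e\|$ implies $x=e$. The norm topology of a pseudo-norm is the topology induced by the pseudo-metric $(x,y)\mapsto\|x+y^*\|-\frac{\|\delta x\|+\|\delta y\|}{2}$. A pseudo-metric $d:S\times S\to\mathbb{R}_+$ satisfies $d(x,x)=0$,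 symmetry and the triangle inequality; it is a metric if moreover $d(x,y)=0$ implies $x=y$. It is right-subinvariant if $d(x+y^*,z+y^* )\leqslant d(x,z)$ for all $x,y,z\in S$. On a Clifford semigroup it is skew-convex if (i) $d(x,y)\geqslant d(\delta x,\delta y)$ for all $x,y$, and (ii) $d(x,z)=d(\delta x,\delta y)+d(x+y^*,z+y^* )$ for all $x,y,z$ with $\delta x\leqslant_S\delta y\leqslant_S\delta z$. *)

theory Defs
  imports "HOL-Analysis.Abstract_Topology"
begin

class inverse_semigroup_add = semigroup_add +
  assumes ex1_star: "\<exists>!y. x + y + x = x \<and> y + x + y = y"
begin

definition star :: "'a \<Rightarrow> 'a" where
  "star x = (THE y. x + y + x = x \<and> y + x + y = y)"

lemma star_props: "x + star x + x = x" "star x + x + star x = star x"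
  using theI'[OF ex1_star, of x] unfolding star_def by auto

definition idem :: "'a set" where
  "idem = {e. e + e = e}"

text \<open>The natural partial order is oriented so that, in a monoid, \<open>0\<close> is below
  every idempotent.\<close>

definition nat_le :: "'a \<Rightarrow> 'a \<Rightarrow> bool" where
  "nat_le x y \<longleftrightarrow> (\<exists>e\<in>idem. y = x + e)"

definition delta :: "'a \<Rightarrow> 'a" where
  "delta x = x + star x"

definition local_monoid :: "'a \<Rightarrow> 'a set" where
  "local_monoid e = {x. x + e = x \<and> e + x = x}"

end

class inverse_monoid_add = inverse_semigroup_add + monoid_add

class clifford_semigroup_add = inverse_semigroup_add +
  assumes star_commute: "x + star x = star x + x"

class clifford_monoid_add = clifford_semigroup_add + inverse_monoid_add

definition pseudo_metric :: "('a \<Rightarrow> 'a \<Rightarrow> real) \<Rightarrow> bool" where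
  "pseudo_metric d \<longleftrightarrow>
     (\<forall>x y. 0 \<le> d x y) \<and>
     (\<forall>x. d x x = 0) \<and>
     (\<forall>x y. d x y = d y x) \<and>
     (\<forall>x y z. d x z \<le> d x y + d y z)"

definition is_metric :: "('a \<Rightarrow> 'a \<Rightarrow> real) \<Rightarrow> bool" where
  "is_metric d \<longleftrightarrow> pseudo_metric d \<and> (\<forall>x y. d x y = 0 \<longrightarrow> x = y)"

definition right_subinvariant :: "('a::inverse_semigroup_add \<Rightarrow> 'a \<Rightarrow> real) \<Rightarrow> bool" where
  "right_subinvariant d \<longleftrightarrow> (\<forall>x y z. d (x + star y) (z + star y) \<le> d x z)"

definition skew_convex :: "('a::clifford_semigroup_add \<Rightarrow> 'a \<Rightarrow> real) \<Rightarrow> bool" where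
  "skew_convex d \<longleftrightarrow>
     (\<forall>x y. d x y \<ge> d (delta x) (delta y)) \<and>
     (\<forall>x y z. nat_le (delta x) (delta y) \<and> nat_le (delta y) (delta z) \<longrightarrow>
        d x z = d (delta x) (delta y) + d (x + star y) (z + star y))"

definition pseudo_norm :: "('a::inverse_monoid_add \<Rightarrow> real) \<Rightarrow> bool" where
  "pseudo_norm v \<longleftrightarrow>
     (\<forall>x. 0 \<le> v x) \<and>
     v 0 = 0 \<and>
     (\<forall>x y. v (x + star y) = v (y + star x)) \<and>
     (\<forall>x y. v (x + star x) \<le> v (x + star y)) \<and>
     (\<forall>x y z. v (x + star y) + v (z + star z) \<le> v (x + star z) + v (z + star y))"

definition is_norm :: "('a::inverse_monoid_add \<Rightarrow> real) \<Rightarrow> bool" where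
  "is_norm v \<longleftrightarrow>
     pseudo_norm v \<and> (\<forall>e\<in>idem. \<forall>x\<in>local_monoid e. v x = v e \<longrightarrow> x = e)"

text \<open>The library's \<open>mtopology\<close> requires a genuine metric, so the topology of a
  pseudo-metric is introduced here.\<close>

definition induced_topology :: "('a \<Rightarrow> 'a \<Rightarrow> real) \<Rightarrow> 'a topology" where
  "induced_topology d = topology (\<lambda>U. \<forall>x\<in>U. \<exists>r>0. \<forall>y. d x y < r \<longrightarrow> y \<in> U)"

lemma openin_induced_topology:
  "openin (induced_topology d) U \<longleftrightarrow> (\<forall>x\<in>U. \<exists>r>0. \<forall>y. d x y < r \<longrightarrow> y \<in> U)"
proof -
  have "istopology (\<lambda>U. \<forall>x\<in>U. \<exists>r>0. \<forall>y. d x y < r \<longrightarrow> y \<in> U)"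
    unfolding istopology_def
  proof (intro conjI allI impI ballI)
    fix S T x
    assume S: "\<forall>x\<in>S. \<exists>r>0. \<forall>y. d x y < r \<longrightarrow> y \<in> S"
      and T: "\<forall>x\<in>T. \<exists>r>0. \<forall>y. d x y < r \<longrightarrow> y \<in> T" and x: "x \<in> S \<inter> T"
    obtain r s where "r > 0" "\<forall>y. d x y < r \<longrightarrow> y \<in> S" "s > 0" "\<forall>y. d x y < s \<longrightarrow> y \<in> T"
      using S T x by blast
    then show "\<exists>r>0. \<forall>y. d x y < r \<longrightarrow> y \<in> S \<inter> T"
      by (intro exI[of _ "min r s"]) auto
  next
    fix K x
    assume "\<forall>S\<in>K. \<forall>x\<in>S. \<exists>r>0. \<forall>y. d x y < r \<longrightarrow> y \<in> S" "x \<in> \<Union>K"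
    then show "\<exists>r>0. \<forall>y. d x y < r \<longrightarrow> y \<in> \<Union>K"
      by (meson Union_iff)
  qed
  then show ?thesis
    by (simp add: induced_topology_def)
qed

definition norm_dist :: "('a::inverse_monoid_add \<Rightarrow> real) \<Rightarrow> 'a \<Rightarrow> 'a \<Rightarrow> real" where
  "norm_dist v x y = v (x + star y) - (v (delta x) + v (delta y)) / 2"

definition norm_topology :: "('a::inverse_monoid_add \<Rightarrow> real) \<Rightarrow> 'a topology" where
  "norm_topology v = induced_topology (norm_dist v)"

end

(* Write e = delta x, f = delta y, g = e + f. Skew-convexity gives v x = 2 d(0, e) + d(e, x) and makes
   d(0, _) additive along chains of idempotents; right-subinvariance turns d(g, x + star y) into
   d(x + f, y + e). Hence the norm distance of x and y equals d(e, g) + d(f, g) + d(x + f, y + e),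
   which lies between d(x, y) and 3 d(x, y). *)

theory Submission
  imports Defs
begin

subsection \<open>Inverse and Clifford semigroups\<close>

lemma star_eqI:
  fixes x y :: "'a::inverse_semigroup_add"
  assumes "x + y + x = x" "y + x + y = y"
  shows "star x = y"
  using ex1_star[of x] star_props[of x] assms by auto

lemma star_star [simp]: "star (star x) = (x::'a::inverse_semigroup_add)"
  by (rule star_eqI) (simp_all add: star_props)

lemma star_idem:
  fixes e :: "'a::inverse_semigroup_add"
  assumes "e \<in> idem"
  shows "star e = e"
  using assms by (intro star_eqI) (simp_all add: idem_def)

lemma delta_idem [simp]: "delta (x::'a::inverse_semigroup_add) \<in> idem"
  by (simp add: idem_def delta_def add.assoc[symmetric] star_props)

lemma star_delta_idem: "star x + (x::'a::inverse_semigroup_add) \<in> idem"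
  using delta_idem[of "star x"] by (simp add: delta_def)

lemma delta_of_idem: "e \<in> idem \<Longrightarrow> delta e = (e::'a::inverse_semigroup_add)"
  by (simp add: delta_def star_idem) (simp add: idem_def)

lemma delta_add_self [simp]: "delta x + x = (x::'a::inverse_semigroup_add)"
  by (simp add: delta_def star_props)

text \<open>Uniqueness of inverses gives \<open>y = f + y + e\<close> for the inverse
  \<open>y\<close> of \<open>e + f\<close>. This makes \<open>y\<close> idempotent, hence its own
  inverse, so it equals \<open>e + f\<close>.\<close>

lemma idem_add:
  fixes e f :: "'a::inverse_semigroup_add"
  assumes e: "e \<in> idem" and f: "f \<in> idem"
  shows "e + f \<in> idem"
proof -
  define y where "y = star (e + f)"
  have ee: "e + e = e" "\<And>z. e + (e + z) = e + z" and ff: "f + f = f" "\<And>z. f + (f + z) = f + z"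
    using e f by (simp_all add: idem_def add.assoc[symmetric])
  have y: "e + (f + (y + (e + f))) = e + f" "y + (e + (f + y)) = y"
    using star_props[of "e + f"] by (simp_all add: y_def add.assoc)
  have y': "y + (e + (f + (y + z))) = y + z" for z
    using y(2) by (metis add.assoc)
  have "y = f + y + e"
    unfolding y_def
    by (rule star_eqI) (simp_all add: y_def[symmetric] add.assoc ee ff y y')
  \<comment> \<open>In \<open>(f + y + e) + (f + y + e)\<close> the middle part
    \<open>y + e + f + y\<close> collapses to \<open>y\<close>.\<close>
  then have "y + y = y"
    by (metis y' add.assoc)
  then have "y \<in> idem"
    by (simp add: idem_def)
  then have "star y = y"
    by (rule star_idem)
  then have "e + f = y"
    by (simp add: y_def)
  with \<open>y \<in> idem\<close> show ?thesis
    by simp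
qed

text \<open>Both sums are idempotent, so \<open>f + e\<close> is an inverse of \<open>e + f\<close>;
  but an idempotent is its own inverse.\<close>

lemma idem_commute:
  fixes e f :: "'a::inverse_semigroup_add"
  assumes e: "e \<in> idem" and f: "f \<in> idem"
  shows "e + f = f + e"
proof -
  have ee: "e + e = e" "\<And>z. e + (e + z) = e + z" and ff: "f + f = f" "\<And>z. f + (f + z) = f + z"
    using e f by (simp_all add: idem_def add.assoc[symmetric])
  have "e + (f + (e + f)) = e + f" "f + (e + (f + e)) = f + e"
    using idem_add[OF e f] idem_add[OF f e] by (simp_all add: idem_def add.assoc)
  then have "star (e + f) = f + e"
    by (intro star_eqI) (simp_all add: add.assoc ee ff)
  then show ?thesis
    using star_idem[OF idem_add[OF e f]] by simp
qed

text \<open>The inverse laws follow once the adjacent idempotents \<open>y + star y\<close> and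
  \<open>star x + x\<close> are swapped.\<close>

lemma star_add: "star (x + y) = star y + star (x::'a::inverse_semigroup_add)"
proof (rule star_eqI)
  note [simp del] = add.assoc
  have c: "(y + star y) + (star x + x) = (star x + x) + (y + star y)"
    using idem_commute[OF delta_idem[of y] star_delta_idem[of x]] by (simp add: delta_def)
  have "x + y + (star y + star x) + (x + y) = x + ((y + star y) + (star x + x)) + y"
    by (simp add: add.assoc)
  also have "\<dots> = (x + star x + x) + (y + star y + y)"
    unfolding c by (simp add: add.assoc)
  finally show "x + y + (star y + star x) + (x + y) = x + y"
    by (simp add: star_props)
  have "star y + star x + (x + y) + (star y + star x)
      = star y + ((star x + x) + (y + star y)) + star x"
    by (simp add: add.assoc)
  also have "\<dots> = (star y + y + star y) + (star x + x + star x)"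
    unfolding c[symmetric] by (simp add: add.assoc)
  finally show "star y + star x + (x + y) + (star y + star x) = star y + star x"
    by (simp add: star_props)
qed

lemma delta_star [simp]: "delta (star x) = delta (x::'a::clifford_semigroup_add)"
  using star_commute[of x] by (simp add: delta_def)

lemma add_delta_self [simp]: "x + delta x = (x::'a::clifford_semigroup_add)"
  unfolding delta_def star_commute by (simp add: add.assoc[symmetric] star_props)

text \<open>The Clifford law for \<open>x + e\<close> yields
  \<open>x + e + star x = e + delta x\<close>; adding \<open>x\<close> on the right turns the two
  sides into \<open>x + e\<close> and \<open>e + x\<close>.\<close>

lemma idem_central:
  fixes e x :: "'a::clifford_semigroup_add"
  assumes e: "e \<in> idem"
  shows "x + e = e + x"
proof -
  have ee: "e + e = e"
    using e by (simp add: idem_def)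
  have sx: "star x + x = delta x"
    by (simp add: delta_def star_commute)
  have "(x + e) + star (x + e) = star (x + e) + (x + e)"
    by (rule star_commute)
  then have "x + (e + e) + star x = e + (star x + x) + e"
    by (simp add: star_add star_idem[OF e] add.assoc)
  also have "\<dots> = e + (e + delta x)"
    by (simp only: sx add.assoc idem_commute[OF delta_idem[of x] e])
  finally have *: "x + e + star x = e + delta x"
    by (simp add: ee add.assoc[symmetric])
  have "x + e = x + (delta x + e)"
    by (simp add: add.assoc[symmetric])
  also have "\<dots> = x + (e + delta x)"
    by (simp add: idem_commute[OF e delta_idem])
  also have "\<dots> = (x + e + star x) + x"
    by (simp add: delta_def star_commute add.assoc)
  also have "\<dots> = e + x"
    unfolding * by (simp add: add.assoc)
  finally show ?thesis .
qed

lemma delta_add: "delta (x + y) = delta x + delta (y::'a::clifford_semigroup_add)"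
proof -
  have "delta (x + y) = x + delta y + star x"
    by (simp add: delta_def star_add add.assoc)
  also have "\<dots> = delta y + delta x"
    by (simp add: idem_central[OF delta_idem] delta_def[of x] add.assoc)
  finally show ?thesis
    by (simp add: idem_commute[of "delta x"])
qed

lemma zero_idem [simp]: "(0::'a::inverse_monoid_add) \<in> idem"
  by (simp add: idem_def)

subsection \<open>Skew-convex pseudo-metrics\<close>

locale skew_convex_pseudo_metric =
  fixes d :: "'a::clifford_monoid_add \<Rightarrow> 'a \<Rightarrow> real"
  assumes pm: "pseudo_metric d" and ri: "right_subinvariant d" and sc: "skew_convex d"
begin

lemma d_nonneg: "0 \<le> d x y" and d_refl [simp]: "d x x = 0" and d_sym: "d x y = d y x"
  and d_triangle: "d x z \<le> d x y + d y z"
  using pm by (auto simp: pseudo_metric_def)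

lemma d_add_right: "d (x + y) (z + y) \<le> d x z"
  using ri star_star[of y] unfolding right_subinvariant_def by metis

lemma d_delta_le: "d (delta x) (delta y) \<le> d x y"
  using sc by (simp add: skew_convex_def)

text \<open>Skew-convexity with idempotents in the first two places: \<open>e\<close> below
  \<open>f\<close> gives \<open>e + star f = f\<close>.\<close>

lemma d_chain:
  assumes "e \<in> idem" "f \<in> idem" "nat_le e f" "nat_le f (delta z)"
  shows "d e z = d e f + d f (z + f)"
proof -
  have "d e z = d (delta e) (delta f) + d (e + star f) (z + star f)"
    using sc assms unfolding skew_convex_def by (metis delta_of_idem)
  moreover have "e + f = f"
    using assms unfolding nat_le_def idem_def by (auto simp: add.assoc[symmetric])
  ultimately show ?thesis
    by (simp add: delta_of_idem star_idem assms)
qed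

lemma d_zero_add:
  assumes "e \<in> idem" "f \<in> idem"
  shows "d 0 (e + f) = d 0 e + d e (e + f)"
proof -
  have "nat_le 0 e" "nat_le e (delta (e + f))"
    using assms by (auto simp: nat_le_def delta_of_idem idem_add)
  moreover have "e + f + e = e + f"
    using assms idem_commute[of e f] by (simp add: add.assoc) (simp add: idem_def add.assoc[symmetric])
  ultimately show ?thesis
    using d_chain[of 0 e "e + f"] assms by simp
qed

lemma d_zero: "d 0 x = d 0 (delta x) + d (delta x) x"
proof -
  have "nat_le 0 (delta x)" "nat_le (delta x) (delta x)"
    using delta_idem[of x] by (auto simp: nat_le_def idem_def intro!: bexI[of _ "delta x"])
  then show ?thesis
    using d_chain[of 0 "delta x" x] by simp
qed

text \<open>Right translation by \<open>star y\<close> carries the pair \<open>x + delta y\<close>,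
  \<open>y + delta x\<close> to \<open>x + star y\<close>, \<open>delta x + delta y\<close>, and
  translation by \<open>y\<close> carries it back. Neither increases distance.\<close>

lemma d_diff: "d (delta x + delta y) (x + star y) = d (x + delta y) (y + delta x)"
proof (rule antisym)
  have 1: "x + delta y + star y = x + star y"
    by (metis add.assoc delta_add_self delta_star)
  have 2: "y + delta x + star y = delta x + delta y"
    by (simp add: idem_central[OF delta_idem] delta_def[of y] add.assoc)
  show "d (delta x + delta y) (x + star y) \<le> d (x + delta y) (y + delta x)"
    using d_add_right[of "x + delta y" "star y" "y + delta x"] unfolding 1 2 by (simp add: d_sym)
  have 3: "x + star y + y = x + delta y"
    by (simp add: delta_def star_commute add.assoc)
  have 4: "delta x + delta y + y = y + delta x"
    by (simp add: idem_central[OF delta_idem, of y] add.assoc)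
  show "d (x + delta y) (y + delta x) \<le> d (delta x + delta y) (x + star y)"
    using d_add_right[of "x + star y" y "delta x + delta y"] unfolding 3 4 by (simp add: d_sym)
qed

section \<open>The map \<open>v\<close>: norm distance, pseudo-norm axioms and topology\<close>

definition v :: "'a \<Rightarrow> real" where
  "v x = d x 0 + d (delta x) 0"

lemma v_alt: "v x = 2 * d 0 (delta x) + d (delta x) x"
  using d_zero[of x] by (simp add: v_def d_sym)

lemma v_idem: "e \<in> idem \<Longrightarrow> v e = 2 * d 0 e"
  by (simp add: v_alt delta_of_idem)

lemma v_diff: "v (x + star y) = 2 * d 0 (delta x + delta y) + d (x + delta y) (y + delta x)"
  by (simp add: v_alt delta_add d_diff)

text \<open>Of the two copies of \<open>d 0 (delta x + delta y)\<close> in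
  \<open>v (x + star y)\<close>, one is split at \<open>delta x\<close> and the other at
  \<open>delta y\<close>; the averaged norms then cancel.\<close>

lemma norm_dist_v:
  "norm_dist v x y = d (delta x) (delta x + delta y) + d (delta y) (delta x + delta y)
     + d (x + delta y) (y + delta x)"
  using d_zero_add[of "delta x" "delta y"] d_zero_add[of "delta y" "delta x"]
  by (simp add: norm_dist_def v_diff v_idem idem_commute[of "delta y" "delta x"] field_simps)

text \<open>Right translation by \<open>a\<close> maps \<open>delta a\<close> to \<open>a\<close>
  and \<open>delta a + e\<close> to \<open>a + e\<close>, so a shift by an idempotent is controlled
  by distances between idempotents.\<close>

lemma d_add_idem_le:
  assumes "e \<in> idem"
  shows "d a (a + e) \<le> d (delta a) (delta a + e)"
proof -
  have "delta a + e + a = a + e"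
    using idem_central[OF assms, of a] by (metis add.assoc delta_add_self)
  with d_add_right[of "delta a" a "delta a + e"] show ?thesis
    by simp
qed

text \<open>Triangle inequality along the path \<open>x\<close>, \<open>x + delta y\<close>,
  \<open>y + delta x\<close>, \<open>y\<close>.\<close>

lemma d_le_norm_dist: "d x y \<le> norm_dist v x y"
proof -
  have "d x y \<le> d x (x + delta y) + d (x + delta y) (y + delta x) + d y (y + delta x)"
    using d_triangle[of x y "x + delta y"] d_triangle[of "x + delta y" y "y + delta x"]
      d_sym[of "y + delta x" y] by linarith
  moreover have "d y (y + delta x) \<le> d (delta y) (delta x + delta y)"
    using d_add_idem_le[of "delta x" y] by (simp add: idem_commute[of "delta y"])
  ultimately show ?thesis
    using d_add_idem_le[of "delta y" x] by (simp add: norm_dist_v)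
qed

text \<open>Each of the three summands of \<open>norm_dist_v\<close> is at most
  \<open>d x y\<close>: translate the pair \<open>delta x\<close>, \<open>delta y\<close> by
  \<open>delta x\<close> or by \<open>delta y\<close>, and the pair \<open>x\<close>,
  \<open>y\<close> by \<open>delta x + delta y\<close>.\<close>

lemma norm_dist_le: "norm_dist v x y \<le> 3 * d x y"
proof -
  have xx: "delta x + delta x = delta x" and yy: "delta y + delta y = delta y"
    using delta_idem unfolding idem_def by blast+
  have c: "delta y + delta x = delta x + delta y"
    by (rule idem_commute) simp_all
  have "d (delta x) (delta x + delta y) \<le> d (delta x) (delta y)"
    using d_add_right[of "delta x" "delta x" "delta y"] by (simp add: xx c)
  moreover have "d (delta y) (delta x + delta y) \<le> d (delta x) (delta y)"
    using d_add_right[of "delta x" "delta y" "delta y"] by (simp add: yy d_sym)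
  moreover have "d (x + delta y) (y + delta x) \<le> d x y"
  proof -
    have "x + (delta x + delta y) = x + delta y" "y + (delta x + delta y) = y + delta x"
      by (simp add: add.assoc[symmetric], metis add.assoc add_delta_self c)
    then show ?thesis
      using d_add_right[of x "delta x + delta y" y] by simp
  qed
  ultimately show ?thesis
    using d_delta_le[of x y] by (simp add: norm_dist_v)
qed

text \<open>By \<open>v_diff\<close> the claim concerns \<open>d 0\<close> on idempotents and
  distances such as \<open>d a b\<close>. Bounding \<open>d a b\<close> requires a detour through
  \<open>a + h\<close> and \<open>b + h\<close>, whose cost is covered by the slack in the
  idempotent part.\<close>

lemma v_triangle: "v (x + star y) + v (z + star z) \<le> v (x + star z) + v (z + star y)"
proof -
  define e f h where efh: "e = delta x" "f = delta y" "h = delta z"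
  have i: "e \<in> idem" "f \<in> idem" "h \<in> idem" "e + f \<in> idem" "h + f \<in> idem"
    by (simp_all add: efh idem_add)
  note c = idem_central[OF i(1)] idem_central[OF i(2)] idem_central[OF i(3)]
  have hh: "h + h = h"
    using i by (simp add: idem_def)
  define a b where ab: "a = x + f" "b = y + e"
  have dab: "delta a = e + f" "delta b = e + f"
    by (simp_all add: ab delta_add delta_of_idem i c(1)[of f] flip: efh)
  \<comment> \<open>Submodularity of \<open>d 0\<close> on idempotents: adding \<open>e\<close>
    costs no more at \<open>h + f\<close> than at \<open>h\<close>.\<close>
  have p1: "d 0 (h + f + e) + d 0 h \<le> d 0 (h + e) + d 0 (h + f)"
  proof -
    have "d (h + f) (h + f + e) \<le> d h (h + e)"
      using d_add_right[of h f "h + e"] by (simp add: add.assoc c(1)[of f])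
    then show ?thesis
      using d_zero_add[OF i(3) i(1)] d_zero_add[OF i(5) i(1)] by simp
  qed
  \<comment> \<open>Combined with \<open>p1\<close> and doubled, this pays for both detours, from
    \<open>a\<close> to \<open>a + h\<close> and from \<open>b + h\<close> to
    \<open>b\<close>.\<close>
  have p2: "d 0 (h + f + e) = d 0 (e + f) + d (e + f) (e + f + h)"
    using d_zero_add[OF i(4) i(3)] c(3)[of "e + f"] by (simp add: add.assoc c(1)[of f])
  have "d a b \<le> d a (a + h) + d (a + h) (b + h) + d b (b + h)"
    using d_triangle[of a b "a + h"] d_triangle[of "a + h" b "b + h"] d_sym[of "b + h" b] by linarith
  moreover have "d a (a + h) \<le> d (e + f) (e + f + h)" "d b (b + h) \<le> d (e + f) (e + f + h)"
    using d_add_idem_le[OF i(3)] dab by metis+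
  \<comment> \<open>The intermediate point is \<open>z + e + f\<close>; the two legs are translates
    by \<open>f\<close> and by \<open>e\<close> of the pairs on the right.\<close>
  moreover have "d (a + h) (b + h) \<le> d (x + h) (z + e) + d (z + f) (y + h)"
  proof -
    have 1: "x + h + f = a + h"
      by (simp add: ab add.assoc c(2))
    have 2: "y + h + e = b + h"
      by (simp add: ab add.assoc c(1))
    have 3: "z + f + e = z + e + f"
      by (simp add: add.assoc c(1)[of f])
    show ?thesis
      using d_triangle[of "a + h" "b + h" "z + e + f"] d_add_right[of "x + h" f "z + e"]
        d_add_right[of "z + f" e "y + h"] unfolding 1 2 3 by linarith
  qed
  ultimately have "d a b \<le> 2 * d (e + f) (e + f + h) + d (x + h) (z + e) + d (z + f) (y + h)"
    by linarith
  then show ?thesis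
    using p1 p2 c(1)[of h] unfolding v_diff by (simp add: hh ab flip: efh)
qed

text \<open>By additivity, \<open>d 0\<close> can only grow from \<open>delta x\<close> to
  \<open>delta x + delta y\<close>.\<close>

lemma v_delta_le: "v (x + star x) \<le> v (x + star y)"
proof -
  have "delta x + delta x = delta x"
    using delta_idem[of x] unfolding idem_def by blast
  then show ?thesis
    using d_zero_add[of "delta x" "delta y"] d_nonneg[of "delta x" "delta x + delta y"]
      d_nonneg[of "x + delta y" "y + delta x"] unfolding v_diff by simp
qed

lemma v_commute: "v (x + star y) = v (y + star x)"
  by (simp add: v_diff idem_commute[of "delta x" "delta y"] d_sym[of "x + delta y"])

lemma pseudo_norm_v: "pseudo_norm v"
  unfolding pseudo_norm_def
  using v_commute v_delta_le v_triangle
  by (auto simp: v_def d_nonneg delta_of_idem)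

text \<open>The two distances bound each other up to the factor 3, so balls about a common centre
  are nested both ways.\<close>

lemma induced_topology_eq: "induced_topology d = norm_topology v"
proof (rule topology_eq[THEN iffD2], intro allI)
  fix U
  have "(\<exists>r>0. \<forall>y. d x y < r \<longrightarrow> y \<in> U) \<longleftrightarrow> (\<exists>r>0. \<forall>y. norm_dist v x y < r \<longrightarrow> y \<in> U)" for x
  proof
    assume "\<exists>r>0. \<forall>y. d x y < r \<longrightarrow> y \<in> U"
    then show "\<exists>r>0. \<forall>y. norm_dist v x y < r \<longrightarrow> y \<in> U"
      by (meson d_le_norm_dist le_less_trans)
  next
    assume "\<exists>r>0. \<forall>y. norm_dist v x y < r \<longrightarrow> y \<in> U"
    then obtain r where "r > 0" and r: "\<And>y. norm_dist v x y < r \<Longrightarrow> y \<in> U"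
      by blast
    have "y \<in> U" if "d x y < r / 3" for y
      using r[of y] norm_dist_le[of x y] that by simp
    with \<open>r > 0\<close> show "\<exists>r>0. \<forall>y. d x y < r \<longrightarrow> y \<in> U"
      by (intro exI[of _ "r / 3"]) simp
  qed
  then show "openin (induced_topology d) U \<longleftrightarrow> openin (norm_topology v) U"
    by (simp add: norm_topology_def openin_induced_topology)
qed

section \<open>Norms correspond to metrics\<close>

lemma is_metric_if_norm:
  assumes "is_norm v"
  shows "is_metric d"
  unfolding is_metric_def
proof (intro conjI pm allI impI)
  fix x y
  assume xy: "d x y = 0"
  have N: "x = e" if "e \<in> idem" "x \<in> local_monoid e" "v x = v e" for x e
    using assms that by (simp add: is_norm_def)
  define e f where ef: "e = delta x" "f = delta y"
  have i: "e \<in> idem" "f \<in> idem" "e + f \<in> idem"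
    by (simp_all add: ef idem_add)
  have c: "f + e = e + f"
    using i by (simp add: idem_commute)
  have ee: "e + e = e" and ff: "f + f = f"
    using i by (simp_all add: idem_def)
  \<comment> \<open>The norm distance is at most \<open>3 * d x y = 0\<close>, so its nonnegative
    summands all vanish.\<close>
  have 0: "d e (e + f) = 0" "d f (e + f) = 0" "d (x + f) (y + e) = 0"
    using norm_dist_le[of x y] d_nonneg[of e "e + f"] d_nonneg[of f "e + f"]
      d_nonneg[of "x + f" "y + e"] unfolding norm_dist_v xy ef by linarith+
  \<comment> \<open>The norm condition is applied to \<open>e + f\<close>, first in the local monoid
    of \<open>e\<close> and then in that of \<open>f\<close>, to get \<open>e = f\<close>.\<close>
  have "e + f = e"
  proof (rule N[OF i(1)])
    show "e + f \<in> local_monoid e"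
      by (simp add: local_monoid_def add.assoc c) (simp add: add.assoc[symmetric] ee)
    show "v (e + f) = v e"
      using d_zero_add[OF i(1,2)] 0 by (simp add: v_idem i)
  qed
  moreover have "e + f = f"
  proof (rule N[OF i(2)])
    show "e + f \<in> local_monoid f"
      by (simp add: local_monoid_def add.assoc ff) (simp add: add.assoc[symmetric] c, simp add: add.assoc ff)
    show "v (e + f) = v f"
      using d_zero_add[OF i(2,1)] 0 by (simp add: v_idem i c)
  qed
  ultimately have fe: "f = e"
    by simp
  \<comment> \<open>With \<open>e = f\<close>, the difference \<open>x + star y\<close> lies in the
    local monoid of \<open>e\<close>; adding \<open>y\<close> to the resulting equation recovers
    \<open>x = y\<close>.\<close>
  have "x + star y = e"
  proof (rule N[OF i(1)])
    show "x + star y \<in> local_monoid e"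
      using fe ef idem_central[OF i(1), of "x + star y"]
      by (simp add: local_monoid_def add.assoc[symmetric])
    show "v (x + star y) = v e"
      using 0 fe ee by (simp add: v_diff v_idem i flip: ef)
  qed
  then have "x + star y + y = y"
    using fe ef by (metis delta_add_self)
  moreover have "x + star y + y = x + f"
    by (simp add: ef delta_def star_commute add.assoc)
  ultimately show "x = y"
    using fe ef by simp
qed

lemma is_norm_if_metric:
  assumes "is_metric d"
  shows "is_norm v"
  unfolding is_norm_def
proof (intro conjI pseudo_norm_v ballI impI)
  fix e x
  assume e: "e \<in> idem" and x: "x \<in> local_monoid e" and vx: "v x = v e"
  have M: "x = y" if "d x y = 0" for x y
    using assms that by (simp add: is_metric_def)
  \<comment> \<open>Applying \<open>delta\<close> to \<open>e + x = x\<close> places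
    \<open>delta x\<close> above \<open>e\<close>, so \<open>d 0\<close> is additive along
    \<open>0\<close>, \<open>e\<close>, \<open>delta x\<close>.\<close>
  have "e + delta x = delta x"
    using x delta_add[of e x] e by (simp add: local_monoid_def delta_of_idem)
  then have "d 0 (delta x) = d 0 e + d e (delta x)"
    using d_zero_add[OF e, of "delta x"] by simp
  \<comment> \<open>Now \<open>v x = v e\<close> reads
    \<open>2 * d e (delta x) + d (delta x) x = 0\<close>, a sum of nonnegative terms.\<close>
  then have "d e (delta x) = 0" "d (delta x) x = 0"
    using vx d_nonneg[of e "delta x"] d_nonneg[of "delta x" x]
    unfolding v_idem[OF e] v_alt[of x] by linarith+
  then show "x = e"
    using M by metis
qed

end

theorem theorem7p5:
  fixes d :: "'a::clifford_monoid_add \<Rightarrow> 'a \<Rightarrow> real"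
    and v :: "'a \<Rightarrow> real"
  assumes "pseudo_metric d"
    and "right_subinvariant d"
    and "skew_convex d"
    and "\<And>x. v x = d x 0 + d (delta x) 0"
  shows "pseudo_norm v \<and> induced_topology d = norm_topology v \<and> (is_norm v \<longleftrightarrow> is_metric d)"
proof -
  interpret D: skew_convex_pseudo_metric d
    using assms by unfold_locales
  have "v = D.v"
    using assms(4) by (simp add: fun_eq_iff D.v_def)
  then show ?thesis
    using D.pseudo_norm_v D.induced_topology_eq D.is_metric_if_norm D.is_norm_if_metric by blast
qed

end
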